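(* Let $\mathbf{w}_{2^+}$ be the lexicographically least infinite overlap-free word over $\mathbb{N}$. For every $k\in\mathbb{N}$, the limiting frequency of the letter $k$ in $\mathbf{w}_{2^+}$, i.e. $\lim_{n\to\infty} f(k,n)/n$ where $f(k,n)$ is the number of occurrences of $k$ in the length-$n$ prefix of $\mathbf{w}_{2^+}$, exists and equals $\dfrac{1}{2^k k!\sqrt{e}}$.
   Context: $\mathbb{N}=\{0,1,2,\ldots\}$ is an alphabet with its usual order. An overlap is a word $cxcxc$ with $c$ a letter and $x$ a possibly empty word; overlap-free means having no overlap as a factor. Lexicographic order on infinite words: $x\le y$ if $x=y$ or $x=wcx'$, $y=wdy'$ with letters $c<d$. (The lexicographically least infinite overlap-free word over $\mathbb{N}$ exists; it begins $0010011001002001\cdots$.) *)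

theory Defs
  imports Complex_Main "HOL-Library.Omega_Words_Fun"
begin

definition overlap :: "'a list \<Rightarrow> bool" where
  "overlap v \<longleftrightarrow> (\<exists>c x. v = [c] @ x @ [c] @ x @ [c])"

definition overlap_free :: "'a word \<Rightarrow> bool" where
  "overlap_free w \<longleftrightarrow> \<not> (\<exists>i j. overlap (w [i \<rightarrow> j]))"

definition lex_le :: "'a::linorder word \<Rightarrow> 'a word \<Rightarrow> bool" where
  "lex_le x y \<longleftrightarrow>
     x = y \<or> (\<exists>u c d x' y'. x = u \<frown> [c] \<frown> x' \<and> y = u \<frown> [d] \<frown> y' \<and> c < d)"

definition least_overlap_free :: "nat word \<Rightarrow> bool" where
  "least_overlap_free w \<longleftrightarrow> overlap_free w \<and> (\<forall>v. overlap_free v \<longrightarrow> lex_le w v)"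

text \<open>The definite description is justified by \<open>ex1_least_overlap_free\<close> below.\<close>

definition w2plus :: "nat word" where
  "w2plus = (THE w. least_overlap_free w)"

lemma lex_le_iff:
  "lex_le x y \<longleftrightarrow> x = y \<or> (\<exists>n. (\<forall>i<n. x i = y i) \<and> x n < y n)"
proof
  assume "lex_le x y"
  then show "x = y \<or> (\<exists>n. (\<forall>i<n. x i = y i) \<and> x n < y n)"
    unfolding lex_le_def
  proof (elim disjE exE conjE)
    fix u c d x' y'
    assume x: "x = u \<frown> [c] \<frown> x'" and y: "y = u \<frown> [d] \<frown> y'" and "c < d"
    then have "(\<forall>i<length u. x i = y i) \<and> x (length u) < y (length u)"
      by (simp add: conc_def)
    then show ?thesis by blast
  qed simp
next
  assume "x = y \<or> (\<exists>n. (\<forall>i<n. x i = y i) \<and> x n < y n)"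
  then show "lex_le x y"
  proof (elim disjE exE conjE)
    fix n assume n: "\<forall>i<n. x i = y i" "x n < y n"
    have split: "z = prefix n z \<frown> [z n] \<frown> suffix (Suc n) z" for z :: "'a word"
      by (rule ext) (auto simp: conc_def)
    have "prefix n y = prefix n x"
      using n(1) by (simp add: subsequence_def)
    then show ?thesis
      unfolding lex_le_def using split[of x] split[of y] n(2) by metis
  qed (simp add: lex_le_def)
qed

lemma lex_le_antisym: "lex_le x y \<Longrightarrow> lex_le y x \<Longrightarrow> x = y"
  unfolding lex_le_iff by (metis linorder_neqE_nat order_less_asym order_less_irrefl)

lemma overlap_free_ident: "overlap_free (\<lambda>n::nat. n)"
proof -
  have "\<not> overlap [i..<j]" for i j :: nat
  proof
    assume "overlap [i..<j]"
    then obtain c x where "[i..<j] = [c] @ x @ [c] @ x @ [c]"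
      by (auto simp: overlap_def)
    moreover have "distinct [i..<j]" by simp
    ultimately show False by simp
  qed
  then show ?thesis by (simp add: overlap_free_def subsequence_def)
qed

primrec least_pre :: "nat \<Rightarrow> nat list" where
  "least_pre 0 = []"
| "least_pre (Suc n) = least_pre n @
     [LEAST c. \<exists>v. overlap_free v \<and> prefix (Suc n) v = least_pre n @ [c]]"

lemma ex1_least_overlap_free: "\<exists>!w. least_overlap_free w"
proof -
  define w where "w n = least_pre (Suc n) ! n" for n
  have len: "length (least_pre n) = n" for n
    by (induction n) auto
  have pre: "prefix n w = least_pre n" for n
  proof (induction n)
    case (Suc n)
    then show ?case by (simp add: w_def nth_append len)
  qed simp
  have ext: "\<exists>v. overlap_free v \<and> prefix n v = least_pre n" for n
  proof (induction n)
    case 0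
    then show ?case using overlap_free_ident by auto
  next
    case (Suc n)
    then obtain v where "overlap_free v" "prefix n v = least_pre n" by blast
    then have "\<exists>c v. overlap_free v \<and> prefix (Suc n) v = least_pre n @ [c]"
      by (metis le0 subseq_to_Suc)
    then show ?case unfolding least_pre.simps by (rule LeastI_ex)
  qed
  have "overlap_free w"
    unfolding overlap_free_def
  proof (intro notI, elim exE)
    fix i j assume o: "overlap (w [i \<rightarrow> j])"
    obtain v where v: "overlap_free v" "prefix j v = prefix j w"
      using ext[of j] pre by metis
    have "drop i (prefix j v) = drop i (prefix j w)" using v(2) by simp
    then have "v [i \<rightarrow> j] = w [i \<rightarrow> j]" by simp
    then show False using o v(1) unfolding overlap_free_def by metis
  qed
  moreover have "lex_le w v" if v: "overlap_free v" for v
  proof (cases "w = v")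
    case False
    define n where "n = (LEAST n. w n \<noteq> v n)"
    have "\<exists>n. w n \<noteq> v n" using False by auto
    then have neq: "w n \<noteq> v n" unfolding n_def by (rule LeastI_ex)
    have eq: "\<forall>i<n. w i = v i" unfolding n_def using not_less_Least by blast
    have "prefix n v = prefix n w"
      using eq by (simp add: subsequence_def)
    then have "prefix n v = least_pre n" using pre by simp
    then have "prefix (Suc n) v = least_pre n @ [v n]" by simp
    then have "(LEAST c. \<exists>v. overlap_free v \<and> prefix (Suc n) v = least_pre n @ [c]) \<le> v n"
      using v by (intro Least_le) blast
    then have "w n \<le> v n" unfolding w_def by (simp add: nth_append len)
    then show ?thesis using neq eq unfolding lex_le_iff by (metis le_neq_implies_less)
  qed (simp add: lex_le_def)
  ultimately have "least_overlap_free w" by (simp add: least_overlap_free_def)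
  then show ?thesis
    by (auto simp: least_overlap_free_def intro: lex_le_antisym)
qed

lemma least_overlap_free_w2plus: "least_overlap_free w2plus"
  unfolding w2plus_def using ex1_least_overlap_free by (rule theI')

end

(* The word is S-adic: with the substitutions rho_n(i) = (i ... n 0 ... i-1)^2 for i <= n and
   rho_n(i) = i for i > n, it is the limit of the words rho_0 ... rho_(n-1)(0 1 ... n-1).

   Overlap-freeness. First letters and last letters of the words rho_n(i) are distinct, so an
   overlap in rho_n(v) through a letter > n, which cuts v unambiguously, comes from an overlap
   in v. An overlap with letters <= n lies in rho_n(l) with l strictly increasing, where it is
   excluded by an argument modulo n+1.

   Minimality. The image of i <= n under rho_0 ... rho_n is a square starting with i and ending
   with the corresponding image of i-1 one level below; hence appending any d <= i to it creates
   an overlap, and no letter of the limit word can be decreased.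

   Frequency. Let e(u) be the number of letters k in u minus alpha |u|, and let d_n be the value
   of e on a rotation of the level n images of 0, ..., n. Then d_(n+1) = 2 (n+1) d_n + e(n+1), and
   alpha = 1 / (2^k k! sqrt e) is the value which keeps d_n bounded. So e is O(n^2) on
   prefixes of length less than 2^n. *)
theory Submission
  imports Defs "HOL-Real_Asymp.Real_Asymp"
begin

subsection \<open>Lifting overlaps through substitutions\<close>

definition contains_overlap :: "'a list \<Rightarrow> bool" where
  "contains_overlap u \<longleftrightarrow> (\<exists>p c x s. u = p @ (c # x) @ (c # x) @ c # s)"

lemma contains_overlap_iff: "contains_overlap u \<longleftrightarrow> (\<exists>p v s. u = p @ v @ s \<and> overlap v)"
proof
  assume "contains_overlap u"
  then obtain p c x s where "u = p @ (c # x) @ (c # x) @ c # s"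
    unfolding contains_overlap_def by blast
  then have "u = p @ ([c] @ x @ [c] @ x @ [c]) @ s \<and> overlap ([c] @ x @ [c] @ x @ [c])"
    unfolding overlap_def by auto
  then show "\<exists>p v s. u = p @ v @ s \<and> overlap v" by blast
next
  assume "\<exists>p v s. u = p @ v @ s \<and> overlap v"
  then show "contains_overlap u"
    unfolding overlap_def contains_overlap_def by fastforce
qed

lemma contains_overlap_append:
  assumes "contains_overlap u"
  shows "contains_overlap (p @ u @ s)"
proof -
  from assms obtain p' c x s' where "u = p' @ (c # x) @ (c # x) @ c # s'"
    unfolding contains_overlap_def by blast
  then have "p @ u @ s = (p @ p') @ (c # x) @ (c # x) @ c # (s' @ s)" by simp
  then show ?thesis unfolding contains_overlap_def by blast
qed

text \<open>Distinct first letters make decoding from the left deterministic: as soon as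
  \<open>t\<close> reaches the first letter of an image, that whole image is common, so the image of
  \<open>q\<close> may extend beyond \<open>t\<close>.\<close>

lemma common_prefix_concat_map:
  assumes "\<And>a. f a \<noteq> []" and "\<And>a b. hd (f a) = hd (f b) \<Longrightarrow> a = b"
    and "concat (map f u) = t @ r" and "concat (map f v) = t @ r'"
  shows "\<exists>q u' v'. u = q @ u' \<and> v = q @ v' \<and> length t \<le> length (concat (map f q))"
  using assms(3,4)
proof (induction u arbitrary: v t)
  case Nil
  then show ?case by auto
next
  case (Cons a u)
  show ?case
  proof (cases "t = []")
    case False
    then obtain b v' where v: "v = b # v'" using Cons.prems by (cases v) auto
    have "hd (f a) = hd t" "hd (f b) = hd t"
      using Cons.prems v False assms(1) by (metis concat.simps(2) hd_append list.simps(9))+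
    then have ab: "a = b" using assms(2) by metis
    show ?thesis
    proof (cases "length t \<le> length (f a)")
      case True
      show ?thesis by (rule exI[of _ "[a]"]) (use ab v True in auto)
    next
      case False
      then obtain t' where t: "t = f a @ t'"
        using Cons.prems(1) by (auto simp: append_eq_append_conv2)
      then obtain q u1 v1 where "u = q @ u1" "v' = q @ v1" "length t' \<le> length (concat (map f q))"
        using Cons.IH[of t' v'] Cons.prems v ab by auto
      then have "a # u = (a # q) @ u1 \<and> v = (a # q) @ v1 \<and> length t \<le> length (concat (map f (a # q)))"
        using t v ab by simp
      then show ?thesis by blast
    qed
  qed auto
qed

lemma common_suffix_concat_map:
  assumes "\<And>a. f a \<noteq> []" and "\<And>a b. last (f a) = last (f b) \<Longrightarrow> a = b"
    and "concat (map f u) = r @ t" and "concat (map f v) = r' @ t"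
  shows "\<exists>q u' v'. u = u' @ q \<and> v = v' @ q \<and> length t \<le> length (concat (map f q))"
proof -
  have rev: "concat (map (\<lambda>a. rev (f a)) (rev x)) = rev (concat (map f x))" for x
    by (induction x) auto
  have "\<exists>q u' v'. rev u = q @ u' \<and> rev v = q @ v' \<and>
      length (rev t) \<le> length (concat (map (\<lambda>a. rev (f a)) q))"
    using assms by (intro common_prefix_concat_map[where r = "rev r" and r' = "rev r'"])
      (auto simp: rev hd_rev)
  then obtain q u' v' where *: "rev u = q @ u'" "rev v = q @ v'"
    "length t \<le> length (concat (map (\<lambda>a. rev (f a)) q))" by auto
  have "u = rev u' @ rev q" "v = rev v' @ rev q"
    using *(1,2) by (metis rev_append rev_rev_ident)+
  moreover have "length t \<le> length (concat (map f (rev q)))"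
    using *(3) rev[of "rev q"] by (metis length_rev rev_rev_ident)
  ultimately show ?thesis by blast
qed

text \<open>A letter that occurs only as its own image is a synchronisation point.\<close>

lemma concat_map_split_at:
  assumes "f e = [e]" and "\<And>a. e \<in> set (f a) \<Longrightarrow> a = e"
    and "concat (map f v) = p @ e # s"
  shows "\<exists>a b. v = a @ e # b \<and> concat (map f a) = p \<and> concat (map f b) = s"
  using assms(3)
proof (induction v arbitrary: p)
  case (Cons x v)
  show ?case
  proof (cases "x = e")
    case True
    show ?thesis
    proof (cases p)
      case Nil
      show ?thesis by (rule exI[of _ "[]"]) (use Nil Cons.prems True assms(1) in auto)
    next
      case (Cons y p')
      then have "y = e" "concat (map f v) = p' @ e # s" using Cons.prems True assms(1) by auto
      with Cons.IH[of p'] obtain a b where "v = a @ e # b" "concat (map f a) = p'" "concat (map f b) = s"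
        by blast
      then have "x # v = (e # a) @ e # b \<and> concat (map f (e # a)) = p \<and> concat (map f b) = s"
        using True \<open>y = e\<close> Cons assms(1) by simp
      then show ?thesis by blast
    qed
  next
    case False
    then have "e \<notin> set (f x)" using assms(2) by blast
    then obtain p' where p': "p = f x @ p'" "concat (map f v) = p' @ e # s"
      using Cons.prems by (auto simp: append_eq_append_conv2 append_eq_Cons_conv)
    with Cons.IH[of p'] obtain a b where "v = a @ e # b" "concat (map f a) = p'" "concat (map f b) = s"
      by blast
    then have "x # v = (x # a) @ e # b \<and> concat (map f (x # a)) = p \<and> concat (map f b) = s"
      using p' by simp
    then show ?thesis by blast
  qed
qed simp

text \<open>The letter \<open>e\<close> occurs at corresponding places in both copies of the period
  and cuts \<open>v\<close> there. The stretches on either side of the cuts are compared by the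
  common prefix and suffix lemmas, which yields an overlap in \<open>v\<close> whose period contains
  \<open>e\<close>.\<close>

lemma contains_overlap_lift:
  assumes "\<And>a. f a \<noteq> []"
    and hd: "\<And>a b. hd (f a) = hd (f b) \<Longrightarrow> a = b"
    and last: "\<And>a b. last (f a) = last (f b) \<Longrightarrow> a = b"
    and e: "f e = [e]" "\<And>a. e \<in> set (f a) \<Longrightarrow> a = e"
    and v: "concat (map f v) = p @ (c # x) @ (c # x) @ c # r"
    and "e \<in> set (c # x)"
  shows "contains_overlap v"
proof -
  obtain s t where st: "c # x = s @ e # t" using assms(7) by (meson split_list)
  have "concat (map f v) = (p @ s) @ e # (t @ s @ e # t @ c # r)"
    using v st by simp
  from concat_map_split_at[OF e this] obtain a b0 where
    a: "v = a @ e # b0" "concat (map f a) = p @ s" and "concat (map f b0) = (t @ s) @ e # t @ c # r"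
    by auto
  from concat_map_split_at[OF e this(3)] obtain b b' where
    b: "b0 = b @ e # b'" "concat (map f b) = t @ s" and b': "concat (map f b') = t @ c # r"
    by blast
  obtain q a1 b1 where q: "a = a1 @ q" "b = b1 @ q" "length s \<le> length (concat (map f q))"
    using common_suffix_concat_map[OF assms(1) last a(2) b(2)] by blast
  \<comment> \<open>\<open>s @ [e]\<close> begins with \<open>c\<close>, so the images of
    \<open>b @ [e]\<close> and \<open>b'\<close> have the common prefix
    \<open>t @ [c]\<close>.\<close>
  obtain w where w: "s @ [e] = c # w" using st by (cases s) auto
  have "concat (map f (b @ [e])) = (t @ [c]) @ w" using b(2) e(1) w by simp
  from common_prefix_concat_map[OF assms(1) hd this, of b' r] b' obtain q' b2 b3 where
    q': "b @ [e] = q' @ b2" "b' = q' @ b3" "length (t @ [c]) \<le> length (concat (map f q'))"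
    by auto
  show ?thesis
  proof (cases b2 rule: rev_cases)
    case Nil
    then have "v = a @ (e # b) @ (e # b) @ e # b3" using a b q' by simp
    then show ?thesis unfolding contains_overlap_def by blast
  next
    case (snoc b4 y)
    then have b4: "b = q' @ b4" using q'(1) by simp
    \<comment> \<open>\<open>q\<close> covers \<open>s\<close> and \<open>q'\<close> covers
      \<open>t @ [c]\<close>, together more than the image \<open>t @ s\<close> of \<open>b\<close>;
      hence the suffix \<open>q\<close> and the prefix \<open>q'\<close> of \<open>b\<close> share a
      letter \<open>d\<close>, which starts the overlap.\<close>
    have "length (concat (map f b)) < length (concat (map f q)) + length (concat (map f q'))"
      using q(3) q'(3) b(2) by simp
    then have "length b1 < length q'"
      using q(2) b4 by (auto simp: append_eq_append_conv2 not_less)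
    then obtain d z where z: "q' = b1 @ d # z" "q = d # z @ b4"
      using q(2) b4 by (auto simp: append_eq_append_conv2 neq_Nil_conv)
    have "v = a1 @ (d # z @ b4 @ e # b1) @ (d # z @ b4 @ e # b1) @ d # (z @ b3)"
      using a b q q' z by simp
    then show ?thesis unfolding contains_overlap_def by blast
  qed
qed

subsection \<open>Doubled rotations\<close>

definition double_rotation :: "nat \<Rightarrow> nat \<Rightarrow> nat list" where
  "double_rotation n i =
     (if i \<le> n then [i..<Suc n] @ [0..<i] @ [i..<Suc n] @ [0..<i] else [i])"

lemma double_rotation_nonempty: "double_rotation n i \<noteq> []"
  by (simp add: double_rotation_def)

lemma hd_double_rotation: "hd (double_rotation n i) = i"
  by (auto simp: double_rotation_def hd_append)

lemma last_double_rotation: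
  "last (double_rotation n i) = (if i = 0 then n else if i \<le> n then i - 1 else i)"
  by (auto simp: double_rotation_def last_append)

lemma last_double_rotation_inj:
  "last (double_rotation n i) = last (double_rotation n j) \<Longrightarrow> i = j"
  by (auto simp: last_double_rotation split: if_splits)

lemma set_double_rotation: "set (double_rotation n i) = (if i \<le> n then {..n} else {i})"
  by (auto simp: double_rotation_def)

lemma nth_double_rotation:
  assumes "i \<le> n" "y < 2 * Suc n"
  shows "double_rotation n i ! y = (i + y) mod Suc n"
proof -
  have rot: "([i..<Suc n] @ [0..<i]) ! z = (i + z) mod Suc n" if "z < Suc n" for z
    using that assms(1) by (auto simp: nth_append mod_if)
  have "double_rotation n i = ([i..<Suc n] @ [0..<i]) @ ([i..<Suc n] @ [0..<i])"
    using assms(1) by (simp add: double_rotation_def)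
  moreover have "length ([i..<Suc n] @ [0..<i]) = Suc n" using assms(1) by simp
  ultimately have "double_rotation n i ! y =
      (if y < Suc n then (i + y) mod Suc n else (i + (y - Suc n)) mod Suc n)"
    using rot assms(2) by (simp add: nth_append del: append_assoc)
  also have "\<dots> = (i + y) mod Suc n"
    by (auto simp: le_mod_geq simp flip: Nat.add_diff_assoc)
  finally show ?thesis .
qed

section \<open>Overlap-freeness of images of increasing words\<close>

lemma length_concat_double_rotation:
  "set l \<subseteq> {..n} \<Longrightarrow> length (concat (map (double_rotation n) l)) = 2 * Suc n * length l"
  by (induction l) (auto simp: double_rotation_def)

text \<open>The image length \<open>2 * Suc n\<close> is a multiple of \<open>Suc n\<close>, so
  modulo \<open>Suc n\<close> the offset inside an image can be replaced by the global position
  \<open>y\<close>.\<close>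

lemma nth_concat_double_rotation:
  assumes "set l \<subseteq> {..n}" "y < 2 * Suc n * length l"
  shows "concat (map (double_rotation n) l) ! y = (l ! (y div (2 * Suc n)) + y) mod Suc n"
  using assms
proof (induction l arbitrary: y)
  case (Cons i l)
  have len: "length (double_rotation n i) = 2 * Suc n"
    using Cons.prems by (simp add: double_rotation_def)
  show ?case
  proof (cases "y < 2 * Suc n")
    case True
    then show ?thesis using Cons.prems len
      by (simp add: nth_append nth_double_rotation del: mult_Suc_right)
  next
    case False
    then obtain z where z: "y = 2 * Suc n + z" using le_Suc_ex not_less by blast
    have "concat (map (double_rotation n) (i # l)) ! y = concat (map (double_rotation n) l) ! z"
      using len z by (simp add: nth_append del: mult_Suc_right)
    also have "\<dots> = (l ! (z div (2 * Suc n)) + z) mod Suc n"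
      using Cons.prems z by (intro Cons.IH) auto
    also have "\<dots> = (l ! (z div (2 * Suc n)) + z + 2 * Suc n) mod Suc n"
      by (metis mod_mult_self2 mult.commute)
    also have "\<dots> = ((i # l) ! (y div (2 * Suc n)) + y) mod Suc n"
    proof -
      have "y div (2 * Suc n) = Suc (z div (2 * Suc n))" unfolding z
        by (subst div_add_self1) auto
      then show ?thesis unfolding z by (simp only: nth_Cons_Suc ac_simps)
    qed
    finally show ?thesis .
  qed
qed simp

text \<open>Let \<open>h y\<close> be the letter of \<open>l\<close> whose image covers position
  \<open>y\<close>. Period \<open>P\<close> makes \<open>h (y + P) - h y + P\<close> divisible by
  \<open>N\<close>, and since \<open>h\<close> is monotone with values up to \<open>n\<close>, the
  difference is constant. This forces \<open>N\<close> to divide \<open>P\<close>, and then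
  \<open>h\<close> stays constant on more positions than one image has.\<close>

lemma overlap_free_double_rotations:
  assumes l: "sorted_wrt (<) l" "set l \<subseteq> {..n}"
  shows "\<not> contains_overlap (concat (map (double_rotation n) l))"
proof
  define N where "N = Suc n"
  note nth_z = nth_concat_double_rotation[OF l(2), folded N_def]
  let ?z = "concat (map (double_rotation n) l)"
  assume "contains_overlap ?z"
  then obtain p c x s where z: "?z = p @ (c # x) @ (c # x) @ c # s"
    unfolding contains_overlap_def by blast
  define a P where "a = length p" and "P = Suc (length x)"
  define h where "h y = l ! (y div (2 * N))" for y
  \<comment> \<open>The endpoint \<open>y = a + P\<close> concerns the closing letter
    \<open>c\<close>; it is what separates an overlap from a square.\<close>
  have per: "?z ! y = ?z ! (y + P)" if y: "y \<in> {a..a + P}" for y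
  proof -
    obtain j where j: "y = a + j" "j \<le> P" using y by (auto dest: le_Suc_ex)
    show ?thesis
    proof (cases "j < P")
      case True
      then show ?thesis unfolding z j(1) by (auto simp: nth_append a_def P_def nth_Cons' )
    next
      case False
      then have "j = P" using j by simp
      then show ?thesis unfolding z j(1) by (auto simp: nth_append a_def P_def)
    qed
  qed
  have len: "2 * N * length l \<ge> a + 2 * P + 1"
    using length_concat_double_rotation[OF l(2), folded N_def] unfolding z a_def P_def by simp
  then have idx: "y div (2 * N) < length l" if "y \<le> a + 2 * P" for y
    using that by (intro less_mult_imp_div_less) (simp add: ac_simps)
  have h_mono: "h y \<le> h y'" if "y \<le> y'" "y' \<le> a + 2 * P" for y y'
  proof (cases "y div (2 * N) = y' div (2 * N)")
    case False
    then have "y div (2 * N) < y' div (2 * N)"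
      using div_le_mono[OF that(1), of "2 * N"] by linarith
    then have "l ! (y div (2 * N)) < l ! (y' div (2 * N))"
      using idx[OF that(2)] by (rule sorted_wrt_nth_less[OF l(1)])
    then show ?thesis unfolding h_def by (rule less_imp_le)
  qed (simp add: h_def)
  have h_le: "h y \<le> n" if "y \<le> a + 2 * P" for y
    using idx[OF that] l(2) unfolding h_def by (meson atMost_iff nth_mem subsetD)
  have h_eq: "y div (2 * N) = y' div (2 * N)" if "h y = h y'" "y \<le> a + 2 * P" "y' \<le> a + 2 * P" for y y'
    using idx[OF that(2)] idx[OF that(3)] that(1) sorted_wrt_nth_less[OF l(1)]
    unfolding h_def by (metis linorder_neqE_nat less_irrefl)
  have diff_zero: "(h (y + P) - h y + P) mod N = 0" if y: "y \<in> {a..a + P}" for y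
  proof -
    have lt: "y < 2 * N * length l" "y + P < 2 * N * length l"
      using y len unfolding atLeastAtMost_iff by linarith+
    have "?z ! y = (h y + y) mod N"
      unfolding h_def by (rule nth_z[OF lt(1)])
    moreover have "?z ! (y + P) = (h (y + P) + (y + P)) mod N"
      unfolding h_def by (rule nth_z[OF lt(2)])
    ultimately have "(h (y + P) + (y + P)) mod N = (h y + y) mod N"
      using per[OF y] by metis
    moreover have le: "h y \<le> h (y + P)" using y by (intro h_mono) auto
    ultimately have "N dvd (h (y + P) + (y + P)) - (h y + y)"
      by (subst mod_eq_dvd_iff_nat[symmetric]) auto
    moreover have "(h (y + P) + (y + P)) - (h y + y) = h (y + P) - h y + P" using le by simp
    ultimately show ?thesis by (simp only: dvd_eq_mod_eq_0)
  qed
  have residue_unique: "k = k'" if "k < N" "k' < N" "(k + P) mod N = 0" "(k' + P) mod N = 0" for k k'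
    using that
  proof (induction k k' rule: linorder_wlog)
    case (le k k')
    then have "N dvd (k' + P) - (k + P)" by (metis dvd_diff_nat dvd_eq_mod_eq_0)
    then show ?case using le by (auto dest!: dvd_imp_le)
  qed auto
  text \<open>The differences lie in \<open>{..n}\<close>, so the congruence determines them.\<close>
  have const: "h (y + P) - h y = h (a + P) - h a" if y: "y \<in> {a..a + P}" for y
  proof (rule residue_unique)
    have "h (y + P) \<le> n" "h (a + P) \<le> n" using y by (auto intro: h_le)
    then show "h (y + P) - h y < N" "h (a + P) - h a < N" by (simp_all add: N_def)
  qed (use y in \<open>simp_all only: diff_zero[of y] diff_zero[of a] atLeastAtMost_iff le_add1 order_refl\<close>)
  \<comment> \<open>If \<open>N\<close> divides \<open>P\<close>, the constant difference is 0, so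
    the positions from \<open>a\<close> to \<open>a + 2 * P\<close> lie in one image of length
    \<open>2 * N\<close>, although \<open>N \<le> P\<close>.\<close>
  have False if "P mod N = 0"
  proof -
    have 0: "h (a + P) - h a = 0"
    proof (rule residue_unique)
      show "h (a + P) - h a < N" using h_le[of "a + P"] by (simp add: N_def)
    qed (use that diff_zero[of a] in \<open>simp_all add: N_def\<close>)
    then have "h (a + P + P) \<le> h a" using const[of "a + P"] by simp
    then have "h a = h (a + 2 * P)"
      using h_mono[of a "a + 2 * P"] by (simp add: mult_2 add.assoc)
    then have "a div (2 * N) = (a + 2 * P) div (2 * N)" by (intro h_eq) auto
    moreover have "N \<le> P" using that by (intro dvd_imp_le) (auto simp: P_def)
    then have "(a + 2 * N) div (2 * N) \<le> (a + 2 * P) div (2 * N)" by (intro div_le_mono) auto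
    moreover have "(a + 2 * N) div (2 * N) = Suc (a div (2 * N))"
      by (subst div_add_self2) (simp_all add: N_def)
    ultimately show False by simp
  qed
  moreover have "P mod N = 0"
  proof (cases "h (a + P) - h a = 0")
    case True
    then show ?thesis using diff_zero[of a] by simp
  next
    case False
    \<comment> \<open>\<open>b\<close> is the first jump of \<open>h\<close> after \<open>a\<close>;
      as the difference is constant, \<open>h\<close> also jumps at \<open>b + P\<close>. Jumps
      occur only at multiples of \<open>2 * N\<close>, so \<open>2 * N\<close> divides
      \<open>P\<close>.\<close>
    define b where "b = (LEAST y. h a < h y)"
    have ex: "h a < h (a + P)" using False by simp
    then have b: "h a < h b" "b \<le> a + P" unfolding b_def by (auto intro: LeastI Least_le)
    have "a < b" using b h_mono[of b a] by (metis le_add1 linorder_not_less mult_2 add.assoc)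
    then obtain b' where b': "b = Suc b'" "a \<le> b'" by (cases b) auto
    have "h b' \<le> h a" using not_less_Least[of b' "\<lambda>y. h a < h y"] b' unfolding b_def by auto
    then have "h b' < h b" using b by simp
    then have "b' div (2 * N) \<noteq> b div (2 * N)" unfolding h_def by auto
    then have d1: "b mod (2 * N) = 0" unfolding b' div_Suc by (auto split: if_splits)
    have "h (b' + P) < h (b + P)"
      using const[of b] const[of b'] b b' \<open>h b' < h b\<close> h_mono[of b "b + P"] h_mono[of b' "b' + P"]
      by auto
    then have "(b' + P) div (2 * N) \<noteq> (b + P) div (2 * N)" unfolding h_def by auto
    then have "(b + P) mod (2 * N) = 0" unfolding b' add_Suc div_Suc by (auto split: if_splits)
    with d1 have "P mod (2 * N) = 0" by (metis add_0 mod_add_left_eq)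
    then show ?thesis by (metis dvd_mult_right mod_eq_0_iff_dvd)
  qed
  ultimately show False by blast
qed

section \<open>Passing overlap-freeness from one level to the next\<close>

lemma append_Cons_eq_append3:
  assumes "A @ e # B = p @ U @ s" and "e \<notin> set U"
  shows "(\<exists>s'. A = p @ U @ s') \<or> (\<exists>p'. B = p' @ U @ s)"
proof -
  from assms(1) consider us where "A = p @ us" "us @ e # B = U @ s"
    | us where "p = A @ us" "e # B = us @ U @ s"
    by (auto simp: append_eq_append_conv2)
  then show ?thesis
  proof cases
    case 1
    then obtain vs where "us = U @ vs \<or> (us @ vs = U \<and> e # B = vs @ s)"
      by (auto simp: append_eq_append_conv2)
    then show ?thesis using 1 assms(2) by (cases vs) auto
  next
    case 2
    then show ?thesis using assms(2) by (cases us; cases U) auto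
  qed
qed

text \<open>Letters above \<open>n\<close> are their own images and a factor over smaller letters
  cannot cross them, so each induction step keeps one side of such a letter until none
  remains.\<close>

lemma factor_concat_double_rotation:
  assumes "concat (map (double_rotation n) v) = p @ U @ s" and "set U \<subseteq> {..n}"
  shows "\<exists>a l b. v = a @ l @ b \<and> set l \<subseteq> {..n} \<and>
    (\<exists>p s. concat (map (double_rotation n) l) = p @ U @ s)"
  using assms(1)
proof (induction "length v" arbitrary: v p s rule: less_induct)
  case less
  show ?case
  proof (cases "set v \<subseteq> {..n}")
    case True
    have "v = [] @ v @ []" by simp
    then show ?thesis using True less.prems by blast
  next
    case False
    then obtain e where e: "e \<in> set v" "n < e" by (meson atMost_iff not_le subsetI)
    then obtain a b where v: "v = a @ e # b" by (meson split_list)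
    have "concat (map (double_rotation n) a) @ e # concat (map (double_rotation n) b) = p @ U @ s"
      using less.prems v e by (simp add: double_rotation_def)
    moreover have "e \<notin> set U" using assms(2) e(2) by auto
    ultimately consider s' where "concat (map (double_rotation n) a) = p @ U @ s'"
      | p' where "concat (map (double_rotation n) b) = p' @ U @ s"
      by (auto dest: append_Cons_eq_append3)
    then show ?thesis
    proof cases
      case 1
      have "length a < length v" using v by simp
      from less.hyps[OF this 1] obtain a' l b' where
        l: "a = a' @ l @ b'" "set l \<subseteq> {..n}" "\<exists>p s. concat (map (double_rotation n) l) = p @ U @ s"
        by blast
      then have "v = a' @ l @ (b' @ e # b)" using v by simp
      then show ?thesis using l by blast
    next
      case 2
      have "length b < length v" using v by simp
      from less.hyps[OF this 2] obtain a' l b' where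
        l: "b = a' @ l @ b'" "set l \<subseteq> {..n}" "\<exists>p s. concat (map (double_rotation n) l) = p @ U @ s"
        by blast
      then have "v = (a @ e # a') @ l @ b'" using v by simp
      then show ?thesis using l by blast
    qed
  qed
qed

text \<open>An invariant for iterating the substitutions: each run of letters below \<open>n\<close>
  is strictly increasing, as \<open>overlap_free_double_rotations\<close> requires of its word
  \<open>l\<close>.\<close>

definition ascending_below :: "nat \<Rightarrow> nat list \<Rightarrow> bool" where
  "ascending_below n v \<longleftrightarrow> successively (\<lambda>a b. a < n \<and> b < n \<longrightarrow> a < b) v"

lemma successively_upt:
  assumes "\<And>a. P a (Suc a)"
  shows "successively P [i..<j]"
proof (induction j)
  case (Suc j)
  then show ?case using assms[of "j - 1"] by (cases "i < j") (auto simp: successively_append_iff)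
qed simp

lemma ascending_below_double_rotation: "ascending_below n (double_rotation n i)"
  unfolding ascending_below_def double_rotation_def
  by (cases i) (auto simp: successively_append_iff successively_upt last_append simp del: upt_Suc)

text \<open>Inside a double rotation the only non-ascending steps go from \<open>n\<close> to 0, and
  \<open>n\<close> is not below \<open>n\<close>. Where the images of \<open>a < b \<le> n\<close>
  meet, the letters are \<open>a - 1\<close>, or \<open>n\<close> if \<open>a = 0\<close>, and
  \<open>b\<close>.\<close>

lemma ascending_below_concat_double_rotation:
  assumes "ascending_below (Suc n) v"
  shows "ascending_below n (concat (map (double_rotation n) v))"
  using assms
proof (induction v)
  case (Cons a v)
  show ?case
  proof (cases v)
    case Nil
    then show ?thesis using ascending_below_double_rotation by simp
  next
    case (Cons b v')
    have "hd (concat (map (double_rotation n) v)) = b"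
      using Cons by (simp add: hd_append hd_double_rotation double_rotation_nonempty)
    moreover have "ascending_below (Suc n) v" "a < Suc n \<and> b < Suc n \<longrightarrow> a < b"
      using Cons.prems Cons unfolding ascending_below_def by auto
    ultimately show ?thesis
      using Cons.IH ascending_below_double_rotation[of n a]
      by (auto simp: ascending_below_def successively_append_iff last_double_rotation)
  qed
qed (simp add: ascending_below_def)

lemma overlap_free_concat_double_rotation:
  assumes "\<not> contains_overlap v" and "ascending_below (Suc n) v"
  shows "\<not> contains_overlap (concat (map (double_rotation n) v))"
proof
  assume "contains_overlap (concat (map (double_rotation n) v))"
  then obtain p c x s where z: "concat (map (double_rotation n) v) = p @ (c # x) @ (c # x) @ c # s"
    unfolding contains_overlap_def by blast
  show False
  proof (cases "set (c # x) \<subseteq> {..n}")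
    case True
    have U: "concat (map (double_rotation n) v) = p @ ((c # x) @ (c # x) @ [c]) @ s"
      "set ((c # x) @ (c # x) @ [c]) \<subseteq> {..n}"
      using z True by simp_all
    obtain a l b p' s' where l: "v = a @ l @ b" "set l \<subseteq> {..n}"
      and "concat (map (double_rotation n) l) = p' @ ((c # x) @ (c # x) @ [c]) @ s'"
      using factor_concat_double_rotation[OF U] by blast
    then have "contains_overlap (concat (map (double_rotation n) l))"
      unfolding contains_overlap_def by auto
    moreover have "successively (<) l"
    proof (rule successively_mono[where Q = "(<)"])
      show "successively (\<lambda>a b. a < Suc n \<and> b < Suc n \<longrightarrow> a < b) l"
        using assms(2) l(1) by (simp add: ascending_below_def successively_append_iff)
    qed (use l(2) in auto)
    then have "sorted_wrt (<) l" by (simp add: successively_conv_sorted_wrt)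
    ultimately show False using overlap_free_double_rotations l(2) by blast
  next
    case False
    then obtain e where e: "e \<in> set (c # x)" "n < e" by (meson atMost_iff not_le subsetI)
    have "contains_overlap v"
    proof (rule contains_overlap_lift[OF _ _ _ _ _ z e(1)])
      show "double_rotation n e = [e]" using e(2) by (simp add: double_rotation_def)
      show "e \<in> set (double_rotation n a) \<Longrightarrow> a = e" for a
        using e(2) by (auto simp: set_double_rotation split: if_splits)
    qed (auto simp: double_rotation_nonempty hd_double_rotation dest: last_double_rotation_inj)
    then show False using assms(1) by blast
  qed
qed

subsection \<open>The limit word\<close>

text \<open>The image of \<open>i\<close> under rho_0 ... rho_(n-1), where the substitution of
  largest index acts first.\<close>

primrec block :: "nat \<Rightarrow> nat \<Rightarrow> nat list" where
  "block 0 i = [i]"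
| "block (Suc n) i = concat (map (block n) (double_rotation n i))"

definition expand :: "nat \<Rightarrow> nat list \<Rightarrow> nat list" where
  "expand n v = concat (map (block n) v)"

lemma expand_simps [simp]:
  "expand n [] = []" "expand n (i # v) = block n i @ expand n v"
  "expand n (u @ v) = expand n u @ expand n v"
  by (simp_all add: expand_def)

lemma expand_Suc: "expand (Suc n) v = expand n (concat (map (double_rotation n) v))"
  by (induction v) (simp_all add: expand_def)

lemma block_Suc: "block (Suc n) i = expand n (double_rotation n i)"
  by (simp add: expand_def)

lemma block_large: "n \<le> i \<Longrightarrow> block n i = [i]"
  by (induction n) (simp_all add: double_rotation_def)

lemma block_Cons: "\<exists>x. block n i = i # x"
proof (induction n)
  case (Suc n)
  obtain v where "double_rotation n i = i # v"
    using hd_double_rotation[of n i] double_rotation_nonempty[of n i] by (metis list.collapse)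
  then show ?case using Suc by (auto simp: block_Suc)
qed simp

lemma overlap_free_expand:
  "\<not> contains_overlap v \<Longrightarrow> ascending_below n v \<Longrightarrow> \<not> contains_overlap (expand n v)"
proof (induction n arbitrary: v)
  case 0
  have "concat (map (block 0) v) = v" by (induction v) auto
  then show ?case using 0 by (simp add: expand_def)
next
  case (Suc n)
  then show ?case
    using overlap_free_concat_double_rotation ascending_below_concat_double_rotation
    by (simp add: expand_Suc)
qed

section \<open>Minimality of the letters inside blocks\<close>

text \<open>The first letter is exempt because a block may start with any letter. The overlap must
  already arise from the part \<open>x\<close> of \<open>u\<close>, so it persists under any left
  context.\<close>

definition greedy :: "nat list \<Rightarrow> bool" where
  "greedy u \<longleftrightarrow> (\<forall>x c y d. u = x @ c # y \<longrightarrow> x \<noteq> [] \<longrightarrow> d < c \<longrightarrow> contains_overlap (x @ [d]))"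

lemma greedy_append:
  assumes "greedy u" and "greedy (c # v)" and "\<And>d. d < c \<Longrightarrow> contains_overlap (u @ [d])"
  shows "greedy (u @ c # v)"
  unfolding greedy_def
proof (intro allI impI)
  fix x b y d
  assume eq: "u @ c # v = x @ b # y" and "x \<noteq> []" "d < b"
  from eq consider us where "u = x @ b # us" | us where "x = u @ us" "c # v = us @ b # y"
    by (auto simp: append_eq_append_conv2 append_eq_Cons_conv)
  then show "contains_overlap (x @ [d])"
  proof cases
    case 1
    then show ?thesis using assms(1) \<open>x \<noteq> []\<close> \<open>d < b\<close> unfolding greedy_def by blast
  next
    case 2
    show ?thesis
    proof (cases "us = []")
      case True
      then show ?thesis using 2 assms(3) \<open>d < b\<close> by simp
    next
      case False
      then have "contains_overlap (us @ [d])"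
        using 2(2) assms(2) \<open>d < b\<close> unfolding greedy_def by blast
      from contains_overlap_append[OF this, of u "[]"] show ?thesis using 2 by simp
    qed
  qed
qed

text \<open>Since \<open>block n b\<close> starts with \<open>b\<close>, only the junctions between
  blocks need an argument, and the hypothesis supplies it from the preceding block alone.\<close>

lemma greedy_expand:
  assumes "\<And>i. greedy (block n i)"
    and "successively (\<lambda>a b. \<forall>d<b. contains_overlap (block n a @ [d])) v"
  shows "greedy (expand n v)"
  using assms(2)
proof (induction v)
  case Nil
  then show ?case by (simp add: greedy_def)
next
  case (Cons a v)
  show ?case
  proof (cases v)
    case Nil
    then show ?thesis using assms(1) by simp
  next
    case (Cons b v')
    obtain x where "expand n v = b # x" using block_Cons[of n b] Cons by auto
    moreover have "greedy (expand n v)" using Cons.IH Cons.prems Cons by simp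
    moreover have "\<And>d. d < b \<Longrightarrow> contains_overlap (block n a @ [d])" using Cons.prems Cons by simp
    ultimately show ?thesis using greedy_append[OF assms(1)] by simp
  qed
qed

lemma contains_overlap_block_snoc: "i < n \<Longrightarrow> d \<le> i \<Longrightarrow> contains_overlap (block n i @ [d])"
proof (induction n arbitrary: i d)
  case (Suc n)
  let ?r = "expand n ([i..<Suc n] @ [0..<i])"
  have B: "block (Suc n) i = ?r @ ?r"
    using Suc.prems by (simp add: block_Suc double_rotation_def del: upt_Suc block.simps)
  show ?case
  proof (cases "d = i")
    case True
    have "[i..<Suc n] = i # [Suc i..<Suc n]" using Suc.prems by (intro upt_conv_Cons) auto
    then obtain x where "?r = i # x" using block_Cons[of n i] by (auto simp del: upt_Suc)
    then have "block (Suc n) i @ [d] = [] @ (i # x) @ (i # x) @ i # []"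
      unfolding B using True by simp
    then show ?thesis unfolding contains_overlap_def by blast
  next
    case False
    then obtain j where j: "i = Suc j" "d \<le> j" using Suc.prems by (cases i) auto
    have "contains_overlap (block n j @ [d])" using Suc j by simp
    moreover have "?r = expand n ([i..<Suc n] @ [0..<j]) @ block n j" using j by simp
    then have "block (Suc n) i @ [d] = (?r @ expand n ([i..<Suc n] @ [0..<j])) @ (block n j @ [d]) @ []"
      unfolding B by simp
    ultimately show ?thesis by (metis contains_overlap_append)
  qed
qed simp

lemma successively_snoc_upt:
  assumes "j \<le> n"
  shows "successively (\<lambda>a b. \<forall>d<b. contains_overlap (block n a @ [d])) [i..<Suc j]"
  using assms
  by (induction j) (auto simp: successively_append_iff contains_overlap_block_snoc less_Suc_eq_le)

text \<open>In a double rotation the steps from \<open>a\<close> to \<open>a + 1\<close>, including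
  the middle one from \<open>i - 1\<close> to \<open>i\<close>, are covered by
  \<open>contains_overlap_block_snoc\<close>; at a step from \<open>n\<close> to 0 there is no
  smaller letter.\<close>

lemma greedy_block: "greedy (block n i)"
proof (induction n arbitrary: i)
  case 0
  then show ?case by (simp add: greedy_def Cons_eq_append_conv)
next
  case (Suc n)
  have "successively (\<lambda>a b. \<forall>d<b. contains_overlap (block n a @ [d])) (double_rotation n i)"
  proof (cases "i \<le> n")
    case True
    show ?thesis
    proof (cases i)
      case 0
      then show ?thesis
        using successively_snoc_upt[of n n 0]
        by (simp add: double_rotation_def successively_append_iff del: upt_Suc)
    next
      case (Suc j)
      then show ?thesis
        using True successively_snoc_upt[of n n i] successively_snoc_upt[of j n 0]
          contains_overlap_block_snoc[of j n]
        by (simp add: double_rotation_def successively_append_iff last_upt less_Suc_eq_le hd_append del: upt_Suc)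
    qed
  qed (simp add: double_rotation_def)
  then show ?case unfolding block_Suc by (intro greedy_expand Suc)
qed

section \<open>Finite stages and their limit\<close>

definition stage :: "nat \<Rightarrow> nat list" where
  "stage n = expand n [0..<n]"

lemma overlap_free_stage: "\<not> contains_overlap (stage n)"
  unfolding stage_def
proof (rule overlap_free_expand)
  show "\<not> contains_overlap [0..<n]"
  proof
    assume "contains_overlap [0..<n]"
    then obtain p c x s where "[0..<n] = p @ (c # x) @ (c # x) @ c # s"
      unfolding contains_overlap_def by blast
    then have "distinct (p @ (c # x) @ (c # x) @ c # s)" by (metis distinct_upt)
    then show False by simp
  qed
  show "ascending_below n [0..<n]" unfolding ascending_below_def by (rule successively_upt) simp
qed

text \<open>The leading 0 of \<open>[0..<Suc n]\<close> becomes two copies of 0, ..., n under rho_n,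
  each expanding to \<open>stage n\<close> followed by \<open>n\<close>. Nesting and doubling of the
  stages rest on this.\<close>

lemma stage_Suc: "\<exists>r. stage (Suc n) = stage n @ n # stage n @ n # r"
proof -
  have "[0..<Suc n] = 0 # [1..<Suc n]" by (simp add: upt_conv_Cons)
  then have "stage (Suc n) = expand n (double_rotation n 0) @ expand n (concat (map (double_rotation n) [1..<Suc n]))"
    unfolding stage_def expand_Suc by (simp del: upt_Suc)
  moreover have "expand n (double_rotation n 0) = stage n @ [n] @ stage n @ [n]"
    by (simp add: stage_def double_rotation_def block_large)
  ultimately show ?thesis by simp
qed

lemma length_stage: "2 ^ n \<le> Suc (length (stage n))"
proof (induction n)
  case (Suc n)
  then show ?case using stage_Suc[of n] by auto
qed simp

lemma stage_append: "n \<le> m \<Longrightarrow> \<exists>r. stage m = stage n @ r"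
proof (induction rule: dec_induct)
  case (step m)
  then show ?case using stage_Suc[of m] by auto
qed simp

lemma le_length_stage: "n \<le> length (stage n)"
  using length_stage[of n] less_exp[of n] by linarith

lemma greedy_stage: "greedy (stage n)"
proof -
  have "successively (\<lambda>a b. \<forall>d<b. contains_overlap (block n a @ [d])) [0..<n]"
    using successively_snoc_upt[of "n - 1" n 0] by (cases n) auto
  then show ?thesis unfolding stage_def by (intro greedy_expand greedy_block)
qed

definition stage_limit :: "nat word" where
  "stage_limit i = stage (Suc i) ! i"

lemma stage_limit_eq: "i < length (stage n) \<Longrightarrow> stage_limit i = stage n ! i"
  unfolding stage_limit_def
  using stage_append[of "Suc i" n] stage_append[of n "Suc i"] le_length_stage[of "Suc i"]
  by (cases "Suc i \<le> n") (auto simp: nth_append)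

lemma prefix_stage_limit:
  assumes "N \<le> length (stage n)"
  shows "stage_limit [0 \<rightarrow> N] = take N (stage n)"
  using assms by (intro nth_equalityI) (auto simp: subsequence_def stage_limit_eq)

lemma overlap_free_stage_limit: "overlap_free stage_limit"
  unfolding overlap_free_def
proof (intro notI, elim exE)
  fix i j assume "overlap (stage_limit [i \<rightarrow> j])"
  have "stage_limit [i \<rightarrow> j] = drop i (take j (stage j))"
    unfolding prefix_stage_limit[OF le_length_stage, symmetric] by (simp add: subsequence_def drop_map)
  moreover have "stage j = take i (take j (stage j)) @ drop i (take j (stage j)) @ drop j (stage j)"
    by (metis append.assoc append_take_drop_id)
  ultimately have "contains_overlap (stage j)"
    using \<open>overlap (stage_limit [i \<rightarrow> j])\<close> unfolding contains_overlap_iff by metis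
  then show False using overlap_free_stage by blast
qed

lemma stage_limit_0: "stage_limit 0 = 0"
  by (simp add: stage_limit_def stage_def expand_def double_rotation_def)

lemma stage_limit_least:
  assumes "overlap_free v"
  shows "lex_le stage_limit v"
proof (rule ccontr)
  assume not_le: "\<not> lex_le stage_limit v"
  define n where "n = (LEAST n. stage_limit n \<noteq> v n)"
  have "stage_limit \<noteq> v" using not_le by (auto simp: lex_le_def)
  then have "\<exists>n. stage_limit n \<noteq> v n" by auto
  then have neq: "stage_limit n \<noteq> v n" unfolding n_def by (rule LeastI_ex)
  have eq: "\<forall>i<n. stage_limit i = v i" unfolding n_def using not_less_Least by blast
  have less: "v n < stage_limit n" using not_le neq eq unfolding lex_le_iff by (meson linorder_neqE_nat)
  \<comment> \<open>\<open>greedy\<close> says nothing about the first letter; there nothing is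
    smaller than 0.\<close>
  then have "n \<noteq> 0" using stage_limit_0 by (metis not_less_zero)
  have len: "n < length (stage (Suc n))" using le_length_stage[of "Suc n"] by simp
  then have split: "stage (Suc n) = take n (stage (Suc n)) @ stage_limit n # drop (Suc n) (stage (Suc n))"
    by (simp add: stage_limit_def id_take_nth_drop)
  have "v [0 \<rightarrow> n] = stage_limit [0 \<rightarrow> n]" using eq by (simp add: subsequence_def)
  then have "take n (stage (Suc n)) = v [0 \<rightarrow> n]"
    using prefix_stage_limit[of n "Suc n"] len by simp
  moreover have "v [0 \<rightarrow> n] \<noteq> []" using \<open>n \<noteq> 0\<close> by (simp add: subsequence_def)
  ultimately have "contains_overlap (v [0 \<rightarrow> n] @ [v n])"
    using greedy_stage[of "Suc n"] split less unfolding greedy_def by metis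
  then have "contains_overlap (v [0 \<rightarrow> Suc n])" by (simp add: subsequence_def)
  then obtain p u s where pus: "v [0 \<rightarrow> Suc n] = p @ u @ s" "overlap u"
    unfolding contains_overlap_iff by blast
  have "u = drop (length p) (take (length p + length u) (v [0 \<rightarrow> Suc n]))"
    unfolding pus(1) by simp
  moreover have "length p + length u \<le> Suc n"
    using arg_cong[OF pus(1), of length] by (simp add: subsequence_def)
  ultimately have "u = v [length p \<rightarrow> length p + length u]"
    by (simp add: subsequence_def drop_map take_map del: upt_Suc)
  then show False using assms pus(2) unfolding overlap_free_def by metis
qed

lemma w2plus_eq: "w2plus = stage_limit"
proof (rule lex_le_antisym)
  show "lex_le w2plus stage_limit"
    using least_overlap_free_w2plus overlap_free_stage_limit by (simp add: least_overlap_free_def)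
  show "lex_le stage_limit w2plus"
    using least_overlap_free_w2plus stage_limit_least by (simp add: least_overlap_free_def)
qed

subsection \<open>Letter frequencies\<close>

text \<open>This is e(u); \<open>\<alpha>\<close> stays free until the recursion below singles out
  its value.\<close>

definition discrepancy :: "nat \<Rightarrow> real \<Rightarrow> nat list \<Rightarrow> real" where
  "discrepancy k \<alpha> u = real (count_list u k) - \<alpha> * real (length u)"

lemma discrepancy_Nil [simp]: "discrepancy k \<alpha> [] = 0"
  by (simp add: discrepancy_def)

lemma discrepancy_append [simp]: "discrepancy k \<alpha> (u @ v) = discrepancy k \<alpha> u + discrepancy k \<alpha> v"
  by (simp add: discrepancy_def algebra_simps)

text \<open>This is d_n; by additivity the order of the blocks in a rotation does not
  matter.\<close>

definition rotation_discrepancy :: "nat \<Rightarrow> real \<Rightarrow> nat \<Rightarrow> real" where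
  "rotation_discrepancy k \<alpha> n = (\<Sum>j\<le>n. discrepancy k \<alpha> (block n j))"

lemma discrepancy_expand:
  "discrepancy k \<alpha> (expand n v) = (\<Sum>j\<leftarrow>v. discrepancy k \<alpha> (block n j))"
  by (induction v) auto

lemma discrepancy_block_Suc:
  assumes "i \<le> n"
  shows "discrepancy k \<alpha> (block (Suc n) i) = 2 * rotation_discrepancy k \<alpha> n"
proof -
  have "rotation_discrepancy k \<alpha> n = sum (\<lambda>j. discrepancy k \<alpha> (block n j)) (set ([i..<Suc n] @ [0..<i]))"
    unfolding rotation_discrepancy_def using assms by (intro sum.cong) auto
  also have "\<dots> = (\<Sum>j\<leftarrow>[i..<Suc n] @ [0..<i]. discrepancy k \<alpha> (block n j))"
    by (rule sum.distinct_set_conv_list) auto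
  finally show ?thesis using assms
    by (simp add: block_Suc double_rotation_def discrepancy_expand del: upt_Suc block.simps)
qed

lemma rotation_discrepancy_Suc:
  "rotation_discrepancy k \<alpha> (Suc n) =
     2 * real (Suc n) * rotation_discrepancy k \<alpha> n + discrepancy k \<alpha> [Suc n]"
proof -
  have "rotation_discrepancy k \<alpha> (Suc n) =
      (\<Sum>j\<le>n. discrepancy k \<alpha> (block (Suc n) j)) + discrepancy k \<alpha> (block (Suc n) (Suc n))"
    unfolding rotation_discrepancy_def by simp
  also have "(\<Sum>j\<le>n. discrepancy k \<alpha> (block (Suc n) j)) = (\<Sum>j\<le>n. 2 * rotation_discrepancy k \<alpha> n)"
    by (intro sum.cong refl discrepancy_block_Suc) simp
  finally show ?thesis by (simp add: block_large del: block.simps)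
qed

text \<open>Dividing the recursion by \<open>2 ^ n * fact n\<close> makes it telescope: each letter
  \<open>j\<close> contributes its own discrepancy over \<open>2 ^ j * fact j\<close>, and the
  coefficient of \<open>- \<alpha>\<close> becomes a partial sum of the series for
  \<open>exp (1 / 2)\<close>.\<close>

lemma rotation_discrepancy_eq:
  "rotation_discrepancy k \<alpha> n = 2 ^ n * fact n *
     ((if k \<le> n then 1 / (2 ^ k * fact k) else 0) - \<alpha> * (\<Sum>j\<le>n. (1 / 2) ^ j / fact j))"
proof (induction n)
  case 0
  then show ?case by (auto simp: rotation_discrepancy_def discrepancy_def)
next
  case (Suc n)
  have pos: "(2::real) ^ Suc n * fact (Suc n) \<noteq> 0" by simp
  have d: "discrepancy k \<alpha> [Suc n] =
      2 ^ Suc n * fact (Suc n) * ((if k = Suc n then 1 / (2 ^ k * fact k) else 0)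
        - \<alpha> * ((1 / 2) ^ Suc n / fact (Suc n)))"
    using pos by (auto simp: discrepancy_def power_one_over right_diff_distrib simp del: fact_Suc power_Suc)
  show ?case unfolding rotation_discrepancy_Suc Suc.IH d
    by (auto simp: algebra_simps)
qed

section \<open>Boundedness of the rotation discrepancy\<close>

text \<open>As \<open>fact (j + Suc n)\<close> is at least \<open>fact n\<close>, the terms beyond
  index \<open>n\<close> are dominated by \<open>f n\<close> times the geometric series 1/2 + 1/4 +
  ... = 1, and \<open>f n\<close> cancels the prefactor.\<close>

lemma exp_half_tail:
  defines "S \<equiv> \<lambda>n. \<Sum>j\<le>n. (1 / 2 :: real) ^ j / fact j"
  shows "S n \<le> exp (1 / 2)" and "2 ^ n * fact n * (exp (1 / 2) - S n) \<le> 1"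
proof -
  define f where "f j = (1 / 2 :: real) ^ j / fact j" for j
  have f: "f sums exp (1 / 2)"
    using exp_converges[of "1 / 2 :: real"] unfolding f_def scaleR_conv_of_real of_real_eq_id id_apply
    by (simp only: divide_inverse mult.commute[of "inverse (fact _)"])
  have S: "S n = sum f {..<Suc n}" unfolding S_def f_def lessThan_Suc_atMost ..
  have tail: "(\<lambda>j. f (j + Suc n)) sums (exp (1 / 2) - S n)"
    unfolding S by (rule sums_split_initial_segment[OF f])
  have "0 \<le> exp (1 / 2) - S n" by (rule sums_le[OF _ sums_zero tail]) (simp add: f_def)
  then show "S n \<le> exp (1 / 2)" by simp
  have geo: "(\<lambda>j. f n * (1 / 2) ^ Suc j) sums (f n * 1)"
    by (intro sums_mult power_half_series)
  have "f (j + Suc n) \<le> f n * (1 / 2) ^ Suc j" for j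
  proof -
    have "f (j + Suc n) \<le> (1 / 2) ^ (j + Suc n) / fact n"
      unfolding f_def by (intro divide_left_mono fact_mono) auto
    also have "\<dots> = f n * (1 / 2) ^ Suc j"
      unfolding f_def by (simp add: power_add mult.commute)
    finally show ?thesis .
  qed
  then have "exp (1 / 2) - S n \<le> f n * 1" by (rule sums_le[OF _ tail geo])
  then have "2 ^ n * fact n * (exp (1 / 2) - S n) \<le> 2 ^ n * fact n * f n"
    by (intro mult_left_mono) auto
  also have "\<dots> = 1" by (simp add: f_def power_one_over)
  finally show "2 ^ n * fact n * (exp (1 / 2) - S n) \<le> 1" .
qed

context
  fixes k :: nat and \<alpha> :: real
  assumes \<alpha>: "\<alpha> = 1 / (2 ^ k * fact k * exp (1 / 2))"
begin

lemma frequency_bounds: "0 < \<alpha>" "\<alpha> \<le> 1"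
proof -
  have "(1::real) * 1 * 1 \<le> 2 ^ k * fact k * exp (1 / 2)"
    by (intro mult_mono) (auto simp: fact_ge_1)
  then show "\<alpha> \<le> 1" unfolding \<alpha> by (simp add: divide_le_eq)
qed (simp add: \<alpha>)

text \<open>For \<open>k \<le> n\<close>, the identity
  \<open>\<alpha> * exp (1 / 2) = 1 / (2 ^ k * fact k)\<close> leaves \<open>\<alpha>\<close> times
  a scaled exponential tail. For \<open>n < k\<close> only the negative term is left, and its factor
  \<open>2 ^ n * fact n\<close> is at most \<open>2 ^ k * fact k\<close>.\<close>

lemma abs_rotation_discrepancy_le: "\<bar>rotation_discrepancy k \<alpha> n\<bar> \<le> 1"
proof -
  define S where "S = (\<Sum>j\<le>n. (1 / 2 :: real) ^ j / fact j)"
  have S: "0 \<le> S" "S \<le> exp (1 / 2)" "2 ^ n * fact n * (exp (1 / 2) - S) \<le> 1"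
    using exp_half_tail[of n] unfolding S_def by (auto intro: sum_nonneg)
  have \<alpha>e: "\<alpha> * exp (1 / 2) = 1 / (2 ^ k * fact k)" by (simp add: \<alpha>)
  show ?thesis
  proof (cases "k \<le> n")
    case True
    then have eq: "rotation_discrepancy k \<alpha> n = \<alpha> * (2 ^ n * fact n * (exp (1 / 2) - S))"
      unfolding rotation_discrepancy_eq S_def[symmetric] by (simp add: right_diff_distrib flip: \<alpha>e)
    have "0 \<le> 2 ^ n * fact n * (exp (1 / 2) - S)" using S(2) by simp
    then have "0 \<le> rotation_discrepancy k \<alpha> n" unfolding eq using frequency_bounds by simp
    moreover have "rotation_discrepancy k \<alpha> n \<le> 1 * 1"
      unfolding eq using S \<open>0 \<le> 2 ^ n * fact n * (exp (1 / 2) - S)\<close> frequency_bounds by (intro mult_mono) auto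
    ultimately show ?thesis by simp
  next
    case False
    then have eq: "rotation_discrepancy k \<alpha> n = - (2 ^ n * fact n * (\<alpha> * S))"
      unfolding rotation_discrepancy_eq S_def[symmetric] by simp
    have "2 ^ n * fact n * (\<alpha> * S) \<le> 2 ^ k * fact k * (\<alpha> * exp (1 / 2))"
      using False S frequency_bounds by (intro mult_mono power_increasing fact_mono) auto
    also have "\<dots> = 1" by (simp add: \<alpha>)
    finally show ?thesis unfolding eq using S(1) frequency_bounds by simp
  qed
qed

section \<open>Discrepancy of prefixes and convergence of the frequency\<close>

lemma abs_discrepancy_letter_le: "\<bar>discrepancy k \<alpha> [i]\<bar> \<le> 1"
  using frequency_bounds by (auto simp: discrepancy_def)

lemma abs_discrepancy_block_le: "\<bar>discrepancy k \<alpha> (block n i)\<bar> \<le> 2"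
proof (cases "i < n")
  case True
  then obtain m where "n = Suc m" "i \<le> m" by (cases n) auto
  then show ?thesis using discrepancy_block_Suc[of i m k \<alpha>] abs_rotation_discrepancy_le[of m] by simp
next
  case False
  then show ?thesis using abs_discrepancy_letter_le[of i] by (simp add: block_large)
qed

text \<open>Every complete block before the cut costs at most 2 by
  \<open>abs_discrepancy_block_le\<close>, and the block that is cut costs at most
  \<open>C\<close>.\<close>

lemma abs_discrepancy_take_expand_le:
  assumes "\<And>i N. \<bar>discrepancy k \<alpha> (take N (block n i))\<bar> \<le> C" and "0 \<le> C"
  shows "\<bar>discrepancy k \<alpha> (take N (expand n v))\<bar> \<le> 2 * real (length v) + C"
proof (induction v arbitrary: N)
  case (Cons i v)
  show ?case
  proof (cases "N \<le> length (block n i)")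
    case True
    then show ?thesis using assms(1)[of N i] by simp
  next
    case False
    then have "take N (expand n (i # v)) = block n i @ take (N - length (block n i)) (expand n v)"
      by simp
    then show ?thesis
      using Cons.IH[of "N - length (block n i)"] abs_discrepancy_block_le[of n i] by simp
  qed
qed (use assms(2) in simp)

text \<open>Each level costs 2 for each of at most \<open>2 * Suc n\<close> letters, and these costs
  \<open>4 * Suc n\<close> add up to a quadratic bound.\<close>

lemma abs_discrepancy_take_block_le:
  "\<bar>discrepancy k \<alpha> (take N (block n i))\<bar> \<le> 4 * (real n)\<^sup>2 + 1"
proof (induction n arbitrary: i N)
  case 0
  then show ?case using abs_discrepancy_letter_le[of i] by (cases N) auto
next
  case (Suc n)
  have "\<bar>discrepancy k \<alpha> (take N (block (Suc n) i))\<bar>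
      \<le> 2 * real (length (double_rotation n i)) + (4 * (real n)\<^sup>2 + 1)"
    unfolding block_Suc by (rule abs_discrepancy_take_expand_le[OF Suc]) simp
  moreover have "length (double_rotation n i) \<le> 2 * Suc n" by (auto simp: double_rotation_def)
  then have "real (length (double_rotation n i)) \<le> 2 * real (Suc n)" by linarith
  ultimately show ?case by (simp add: power2_eq_square algebra_simps)
qed

lemma abs_discrepancy_prefix_le:
  assumes "2 ^ n \<le> Suc N" and "Suc N < 2 ^ Suc n"
  shows "\<bar>discrepancy k \<alpha> (stage_limit [0 \<rightarrow> N])\<bar> \<le> 7 * (real (Suc n))\<^sup>2"
proof -
  \<comment> \<open>\<open>stage (Suc n)\<close> has at least \<open>2 ^ Suc n - 1\<close> letters,
    hence the bound on \<open>Suc N\<close>.\<close>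
  have "N \<le> length (stage (Suc n))" using length_stage[of "Suc n"] assms(2) by linarith
  then have "\<bar>discrepancy k \<alpha> (stage_limit [0 \<rightarrow> N])\<bar>
      \<le> 2 * real (length [0..<Suc n]) + (4 * (real (Suc n))\<^sup>2 + 1)"
    by (subst prefix_stage_limit, assumption, subst stage_def)
      (intro abs_discrepancy_take_expand_le abs_discrepancy_take_block_le, simp)
  also have "\<dots> \<le> 7 * (real (Suc n))\<^sup>2"
    by (simp add: power2_eq_square algebra_simps)
  finally show ?thesis .
qed

lemma tendsto_frequency:
  "(\<lambda>N. real (count_list (stage_limit [0 \<rightarrow> N]) k) / real N) \<longlonglongrightarrow> \<alpha>"
proof -
  \<comment> \<open>The bound \<open>7 * (real (Suc n))\<^sup>2\<close> with \<open>n\<close>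
    replaced by its upper bound \<open>log 2 (real (Suc N))\<close>, divided by
    \<open>N\<close>.\<close>
  define g where "g N = 7 * (log 2 (real (Suc N)) + 1)\<^sup>2 / real N" for N
  have "\<bar>real (count_list (stage_limit [0 \<rightarrow> N]) k) / real N - \<alpha>\<bar> \<le> g N" if N: "0 < N" for N
  proof -
    obtain n where n: "2 ^ n \<le> Suc N" "Suc N < 2 ^ Suc n"
      using ex_power_ivl1[of 2 "Suc N"] by auto
    have "(2::real) ^ n \<le> real (Suc N)" using n(1) by (metis of_nat_le_iff of_nat_numeral of_nat_power)
    then have "real n \<le> log 2 (real (Suc N))" by (simp add: le_log_iff powr_realpow)
    then have sq: "(real (Suc n))\<^sup>2 \<le> (log 2 (real (Suc N)) + 1)\<^sup>2" by (intro power_mono) auto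
    have "\<bar>discrepancy k \<alpha> (stage_limit [0 \<rightarrow> N])\<bar> \<le> 7 * (log 2 (real (Suc N)) + 1)\<^sup>2"
      using abs_discrepancy_prefix_le[OF n] sq by linarith
    then have "\<bar>discrepancy k \<alpha> (stage_limit [0 \<rightarrow> N])\<bar> / real N \<le> g N"
      unfolding g_def by (rule divide_right_mono) simp
    moreover have "real (count_list (stage_limit [0 \<rightarrow> N]) k) / real N - \<alpha>
        = discrepancy k \<alpha> (stage_limit [0 \<rightarrow> N]) / real N"
      using N by (simp add: discrepancy_def field_simps)
    ultimately show ?thesis by (simp add: abs_divide)
  qed
  then have ev: "eventually (\<lambda>N. norm (real (count_list (stage_limit [0 \<rightarrow> N]) k) / real N - \<alpha>) \<le> g N) sequentially"
    by (intro eventually_mono[OF eventually_gt_at_top[of 0]]) simp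
  have "g \<longlonglongrightarrow> 0" unfolding g_def by real_asymp
  from tendsto_sandwich[OF _ ev tendsto_const this]
  have "(\<lambda>N. norm (real (count_list (stage_limit [0 \<rightarrow> N]) k) / real N - \<alpha>)) \<longlonglongrightarrow> 0"
    by simp
  then show ?thesis by (rule LIM_zero_cancel[OF tendsto_norm_zero_cancel])
qed

end

theorem theorem13:
  fixes k :: nat
  shows "(\<lambda>n. real (count_list (w2plus [0 \<rightarrow> n]) k) / real n)
           \<longlonglongrightarrow> 1 / (2 ^ k * fact k * sqrt (exp 1))"
proof -
  have "sqrt (exp 1) = exp (1 / 2)"
    by (rule real_sqrt_unique) (simp_all flip: exp_of_nat_mult)
  then show ?thesis unfolding w2plus_eq by (intro tendsto_frequency) simp
qed

end
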